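(* Let $d,n$ be positive integers and let $A$ be either $M_n(\mathbb{R}[x_1,\ldots,x_d])$ or $M_n(\mathbb{H}_c[x_1,\ldots,x_d])$ or $M_n(\mathbb{H}[x_1,\ldots,x_d])$ with the usual involutions. A left ideal of $A$ is real if and only if it is strongly real.
   Context: $\mathbb{H}$ denotes the real quaternions. The ring $\mathbb{R}[x_1,\ldots,x_d]$ carries the trivial involution. $\mathbb{H}_c[x_1,\ldots,x_d]:=\mathbb{H}\otimes_{\mathbb{R}}\mathbb{R}[x_1,\ldots,x_d]$ (variables commute with each other and with $\mathbb{H}$), with involution determined by $x_i^\ast=x_i$ and $c^\ast=\bar c$ for $c\in\mathbb{H}$. $\mathbb{H}[x_1,\ldots,x_d]$ is the ring of all polynomial functions $\mathbb{H}^d\to\mathbb{H}$, i.e. the subring of the ring of all functions $\mathbb{H}^d\to\mathbb{H}$ (with pointwise operations) generated by the constant functions and the coordinate functions $x_i$; its involution is pointwise quaternionic conjugation. For a ring with involution $B$, the ring $M_n(B)$ carries the conjugated transpose involution $[b_{i,j}]^\ast=[b_{j,i}^\ast]$. Let $I$ be a left ideal of a ring with involution $A$. $I$ is real if for every $k$ and all $a_1,\ldots,a_k \in A$ such that $a_1^\ast a_1+\ldots+a_k^\ast a_k \in I$ we have $a_1,\ldots,a_k\in I$. $I$ is strongly real if for every $k$ and all $a_1,\ldots,a_k \in A$ such that $a_1^\ast a_1+\ldots+a_k^\ast a_k \in I+I^\ast$ we have $a_1,\ldots,a_k \in I$, where $I^\ast=\{a^\ast\mid a\in I\}$. *)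

theory Defs
  imports "HOL-Analysis.Analysis" "HOL-Library.Poly_Mapping"
begin

class star_ring = ring_1 +
  fixes star :: "'a \<Rightarrow> 'a"
  assumes star_add: "star (x + y) = star x + star y"
    and star_mult: "star (x * y) = star y * star x"
    and star_star [simp]: "star (star x) = x"
begin

lemma star_zero [simp]: "star 0 = 0"
  using star_add[of 0 0] by simp

lemma star_one [simp]: "star 1 = 1"
  by (metis mult_1 mult_1_right star_mult star_star)

lemma star_eq_zero_iff [simp]: "star x = 0 \<longleftrightarrow> x = 0"
  by (metis star_zero star_star)

lemma star_sum: "star (sum f S) = (\<Sum>i\<in>S. star (f i))"
  by (induction S rule: infinite_finite_induct) (simp_all add: star_add)

end

definition left_ideal :: "'a::ring_1 set \<Rightarrow> bool" where
  "left_ideal I \<longleftrightarrow>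
     0 \<in> I \<and> (\<forall>x\<in>I. \<forall>y\<in>I. x + y \<in> I) \<and> (\<forall>a. \<forall>x\<in>I. a * x \<in> I)"

definition real_left_ideal :: "'a::star_ring set \<Rightarrow> bool" where
  "real_left_ideal I \<longleftrightarrow> left_ideal I \<and>
     (\<forall>(k::nat) (a :: nat \<Rightarrow> 'a). (\<Sum>i<k. star (a i) * a i) \<in> I \<longrightarrow> (\<forall>i<k. a i \<in> I))"

definition strongly_real_left_ideal :: "'a::star_ring set \<Rightarrow> bool" where
  "strongly_real_left_ideal I \<longleftrightarrow> left_ideal I \<and>
     (\<forall>(k::nat) (a :: nat \<Rightarrow> 'a).
        (\<Sum>i<k. star (a i) * a i) \<in> {x + star y |x y. x \<in> I \<and> y \<in> I} \<longrightarrow> (\<forall>i<k. a i \<in> I))"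

instantiation real :: star_ring
begin
definition star_real :: "real \<Rightarrow> real" where "star_real x = x"
instance by standard (simp_all add: star_real_def)
end

datatype quat = Quat (Re_q: real) (I_q: real) (J_q: real) (K_q: real)

lemma quat_eq_iff:
  "x = y \<longleftrightarrow> Re_q x = Re_q y \<and> I_q x = I_q y \<and> J_q x = J_q y \<and> K_q x = K_q y"
  using quat.expand by auto

instantiation quat :: ring_1
begin

definition zero_quat :: quat where "0 = Quat 0 0 0 0"
definition one_quat :: quat where "1 = Quat 1 0 0 0"
definition plus_quat :: "quat \<Rightarrow> quat \<Rightarrow> quat" where
  "x + y = Quat (Re_q x + Re_q y) (I_q x + I_q y) (J_q x + J_q y) (K_q x + K_q y)"
definition uminus_quat :: "quat \<Rightarrow> quat" where
  "- x = Quat (- Re_q x) (- I_q x) (- J_q x) (- K_q x)"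
definition minus_quat :: "quat \<Rightarrow> quat \<Rightarrow> quat" where
  "x - y = Quat (Re_q x - Re_q y) (I_q x - I_q y) (J_q x - J_q y) (K_q x - K_q y)"
definition times_quat :: "quat \<Rightarrow> quat \<Rightarrow> quat" where
  "x * y = Quat
     (Re_q x * Re_q y - I_q x * I_q y - J_q x * J_q y - K_q x * K_q y)
     (Re_q x * I_q y + I_q x * Re_q y + J_q x * K_q y - K_q x * J_q y)
     (Re_q x * J_q y - I_q x * K_q y + J_q x * Re_q y + K_q x * I_q y)
     (Re_q x * K_q y + I_q x * J_q y - J_q x * I_q y + K_q x * Re_q y)"

instance
  by standard
    (simp_all add: quat_eq_iff zero_quat_def one_quat_def plus_quat_def uminus_quat_def
      minus_quat_def times_quat_def algebra_simps)

end

instantiation quat :: star_ring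
begin
definition star_quat :: "quat \<Rightarrow> quat" where
  "star x = Quat (Re_q x) (- I_q x) (- J_q x) (- K_q x)"
instance
  by standard
    (simp_all add: quat_eq_iff plus_quat_def times_quat_def star_quat_def algebra_simps)
end

lemma quat_units:
  defines "i \<equiv> Quat 0 1 0 0" and "j \<equiv> Quat 0 0 1 0" and "k \<equiv> Quat 0 0 0 1"
  shows "i * i = -1" "j * j = -1" "k * k = -1" "i * j * k = -1"
  by (simp_all add: quat_eq_iff one_quat_def uminus_quat_def times_quat_def
      i_def j_def k_def)

text \<open>
  The convolution ring of finitely supported maps from exponent vectors to coefficients. The
  coefficients need not commute with each other, but they commute with the variables, so that
  \<open>('d, quat) mpoly\<close> is the tensor product of the quaternions with \<open>('d, real) mpoly\<close> over
  the reals. The involution acts on the coefficients and fixes the variables.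
\<close>

type_synonym ('d, 'b) mpoly = "('d \<Rightarrow>\<^sub>0 nat) \<Rightarrow>\<^sub>0 'b"

lemma star_Sum_any:
  fixes f :: "'c \<Rightarrow> 'b::star_ring"
  shows "star (Sum_any f) = Sum_any (\<lambda>x. star (f x))"
  by (simp add: Sum_any.expand_set star_sum)

lemma star_prod_fun:
  fixes f g :: "'a::comm_monoid_add \<Rightarrow> 'b::star_ring"
  assumes "finite {a. f a \<noteq> 0}" "finite {a. g a \<noteq> 0}"
  shows "star (prod_fun f g k) = prod_fun (\<lambda>a. star (g a)) (\<lambda>a. star (f a)) k"
proof -
  have "star (prod_fun f g k) = (\<Sum>(a, b). star (g b) * star (f a) when k = a + b)"
    using assms
    by (simp add: prod_fun_unfold_prod star_Sum_any split_def when_def if_distrib star_mult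
        cong: if_cong)
  also have "\<dots> = (\<Sum>(b, a). star (g b) * star (f a) when k = b + a)"
    by (rule Sum_any.reindex_cong[of prod.swap]) (auto simp: add.commute bij_swap fun_eq_iff)
  also have "\<dots> = prod_fun (\<lambda>a. star (g a)) (\<lambda>a. star (f a)) k"
    using assms by (simp add: prod_fun_unfold_prod)
  finally show ?thesis .
qed

instantiation poly_mapping :: (comm_monoid_add, star_ring) star_ring
begin

lift_definition star_poly_mapping :: "('a \<Rightarrow>\<^sub>0 'b) \<Rightarrow> 'a \<Rightarrow>\<^sub>0 'b" is "\<lambda>p m. star (p m)"
  by simp

instance
  by standard (transfer; simp add: fun_eq_iff star_add star_prod_fun)+

end

lemma star_single: "star (Poly_Mapping.single m c) = Poly_Mapping.single m (star c)"
  by transfer (auto simp: when_def)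

inductive_set quat_poly_funs :: "(quat ^ 'd \<Rightarrow> quat) set" where
  const: "(\<lambda>_. c) \<in> quat_poly_funs"
| coord: "(\<lambda>x. x $ i) \<in> quat_poly_funs"
| add: "f \<in> quat_poly_funs \<Longrightarrow> g \<in> quat_poly_funs \<Longrightarrow> (\<lambda>x. f x + g x) \<in> quat_poly_funs"
| uminus: "f \<in> quat_poly_funs \<Longrightarrow> (\<lambda>x. - f x) \<in> quat_poly_funs"
| mult: "f \<in> quat_poly_funs \<Longrightarrow> g \<in> quat_poly_funs \<Longrightarrow> (\<lambda>x. f x * g x) \<in> quat_poly_funs"

lemma quat_poly_funs_diff:
  "f \<in> quat_poly_funs \<Longrightarrow> g \<in> quat_poly_funs \<Longrightarrow> (\<lambda>x. f x - g x) \<in> quat_poly_funs"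
  using quat_poly_funs.add[OF _ quat_poly_funs.uminus, of f g] by simp

lemma star_quat_eq:
  fixes q :: quat
  defines "i \<equiv> Quat 0 1 0 0" and "j \<equiv> Quat 0 0 1 0" and "k \<equiv> Quat 0 0 0 1"
  shows "star q = Quat (-1/2) 0 0 0 * (q + i * q * i + j * q * j + k * q * k)"
  by (simp add: quat_eq_iff star_quat_def plus_quat_def times_quat_def i_def j_def k_def)

lemma quat_poly_funs_star:
  "f \<in> quat_poly_funs \<Longrightarrow> (\<lambda>x. star (f x)) \<in> quat_poly_funs"
  unfolding star_quat_eq by (intro quat_poly_funs.intros)

typedef 'd quat_poly_fun = "quat_poly_funs :: (quat ^ 'd \<Rightarrow> quat) set"
  by (auto intro: quat_poly_funs.const)

setup_lifting type_definition_quat_poly_fun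

instantiation quat_poly_fun :: (finite) star_ring
begin

lift_definition zero_quat_poly_fun :: "'a quat_poly_fun" is "\<lambda>_. 0"
  by (rule quat_poly_funs.const)
lift_definition one_quat_poly_fun :: "'a quat_poly_fun" is "\<lambda>_. 1"
  by (rule quat_poly_funs.const)
lift_definition plus_quat_poly_fun ::
  "'a quat_poly_fun \<Rightarrow> 'a quat_poly_fun \<Rightarrow> 'a quat_poly_fun" is "\<lambda>f g x. f x + g x"
  by (rule quat_poly_funs.add)
lift_definition uminus_quat_poly_fun :: "'a quat_poly_fun \<Rightarrow> 'a quat_poly_fun"
  is "\<lambda>f x. - f x"
  by (rule quat_poly_funs.uminus)
lift_definition minus_quat_poly_fun ::
  "'a quat_poly_fun \<Rightarrow> 'a quat_poly_fun \<Rightarrow> 'a quat_poly_fun" is "\<lambda>f g x. f x - g x"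
  by (rule quat_poly_funs_diff)
lift_definition times_quat_poly_fun ::
  "'a quat_poly_fun \<Rightarrow> 'a quat_poly_fun \<Rightarrow> 'a quat_poly_fun" is "\<lambda>f g x. f x * g x"
  by (rule quat_poly_funs.mult)
lift_definition star_quat_poly_fun :: "'a quat_poly_fun \<Rightarrow> 'a quat_poly_fun"
  is "\<lambda>f x. star (f x)"
  by (rule quat_poly_funs_star)

instance
  by standard (transfer; simp add: fun_eq_iff algebra_simps star_add star_mult)+

end

text \<open>
  A copy of the type \<^typ>\<open>'b ^ 'n ^ 'n\<close>, which itself already carries the entrywise product
  as its ring multiplication.
\<close>

typedef ('b, 'n) sq_matrix = "UNIV :: ('b ^ 'n ^ 'n) set"
  by simp

setup_lifting type_definition_sq_matrix

instantiation sq_matrix :: (star_ring, finite) star_ring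
begin

lift_definition zero_sq_matrix :: "('a, 'b) sq_matrix" is 0 .
lift_definition one_sq_matrix :: "('a, 'b) sq_matrix" is "mat 1" .
lift_definition plus_sq_matrix ::
  "('a, 'b) sq_matrix \<Rightarrow> ('a, 'b) sq_matrix \<Rightarrow> ('a, 'b) sq_matrix" is "(+)" .
lift_definition uminus_sq_matrix :: "('a, 'b) sq_matrix \<Rightarrow> ('a, 'b) sq_matrix" is "uminus" .
lift_definition minus_sq_matrix ::
  "('a, 'b) sq_matrix \<Rightarrow> ('a, 'b) sq_matrix \<Rightarrow> ('a, 'b) sq_matrix" is "(-)" .
lift_definition times_sq_matrix ::
  "('a, 'b) sq_matrix \<Rightarrow> ('a, 'b) sq_matrix \<Rightarrow> ('a, 'b) sq_matrix" is "(**)" .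
lift_definition star_sq_matrix :: "('a, 'b) sq_matrix \<Rightarrow> ('a, 'b) sq_matrix"
  is "\<lambda>A. \<chi> i j. star (A $ j $ i)" .

instance
proof
  fix A B C :: "('a, 'b) sq_matrix"
  show "A * B * C = A * (B * C)"
    by transfer (simp add: matrix_mul_assoc)
  show "(A + B) * C = A * C + B * C"
    by transfer (simp add: vec_eq_iff matrix_matrix_mult_def sum.distrib algebra_simps)
  show "A * (B + C) = A * B + A * C"
    by transfer (simp add: vec_eq_iff matrix_matrix_mult_def sum.distrib algebra_simps)
  show "(0 :: ('a, 'b) sq_matrix) \<noteq> 1"
    by transfer (simp add: vec_eq_iff mat_def)
  show "star (A * B) = star B * star A"
    by transfer (simp add: vec_eq_iff matrix_matrix_mult_def star_sum star_mult)
qed (transfer; simp add: vec_eq_iff star_add algebra_simps)+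

end

end

(*
  All three rings are finitely generated modules over their symmetric centre, and this alone makes
  real left ideals strongly real. Let a_1* a_1 + ... + a_k* a_k = s = b + c* with b, c in the real
  left ideal I. The set K of all z with z A a_i contained in I for every i is a two-sided ideal,
  and it is again real and closed under the involution. The element B = b* b + c* c of I is
  integral over the symmetric centre, so for q = 0, the value at B of a monic polynomial, K contains
  B q and all a_i q. The degree of such a q can be lowered: writing q = e + B q' with e central, the
  relation e a_i = - a_i q' B + a_i q and the realness of I force e a_i to lie in I, so e lies in K,
  hence so do q^2 = e q + q' B q, q and B q'. As q' B q' = (b q')* (b q') + (c q')* (c q'), also
  b q' and c q' lie in K, hence so does q' s q' = q' (b q') + (c q')* q', and thus every a_i q'. At
  degree 0 this shows that a_i lies in K, and then in I.
*)
theory Submission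
  imports Defs
begin

section \<open>The subring of self-adjoint central elements\<close>

definition sym_centre :: "'a::star_ring set" where
  "sym_centre = {z. star z = z \<and> (\<forall>x. z * x = x * z)}"

lemma sym_centre_commute: "z \<in> sym_centre \<Longrightarrow> z * x = x * z"
  and sym_centre_star: "z \<in> sym_centre \<Longrightarrow> star z = z"
  by (auto simp: sym_centre_def)

lemma sym_centre_zero [simp]: "0 \<in> sym_centre"
  and sym_centre_one [simp]: "1 \<in> sym_centre"
  by (auto simp: sym_centre_def)

lemma star_minus: "star (- x) = - star (x::'a::star_ring)"
proof -
  have "star (- x) + star x = 0"
    by (metis star_add add.left_inverse star_zero)
  then show ?thesis by (simp add: eq_neg_iff_add_eq_0)
qed

lemma sym_centreI: "star z = z \<Longrightarrow> (\<And>x. z * x = x * z) \<Longrightarrow> z \<in> sym_centre"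
  by (auto simp: sym_centre_def)

lemma sym_centre_add: "x \<in> sym_centre \<Longrightarrow> y \<in> sym_centre \<Longrightarrow> x + y \<in> sym_centre"
  by (rule sym_centreI)
    (simp_all add: star_add sym_centre_star distrib_left distrib_right sym_centre_commute[of x]
      sym_centre_commute[of y])

lemma sym_centre_minus: "x \<in> sym_centre \<Longrightarrow> - x \<in> sym_centre"
  by (rule sym_centreI) (simp_all add: star_minus sym_centre_star sym_centre_commute[of x])

lemma sym_centre_mult:
  assumes "x \<in> sym_centre" "y \<in> sym_centre"
  shows "x * y \<in> sym_centre"
proof (rule sym_centreI)
  show "star (x * y) = x * y"
    using assms by (metis star_mult sym_centre_star sym_centre_commute)
  show "x * y * v = v * (x * y)" for v
    using assms by (metis mult.assoc sym_centre_commute)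
qed

lemma sym_centre_of_bool [simp]: "of_bool P \<in> sym_centre"
  by (cases P) auto

subsection \<open>Integrality over the symmetric centre\<close>

text \<open>
  Values at \<open>B\<close> of polynomials of formal degree \<open>n\<close> whose coefficients lie in the symmetric
  centre, the coefficient of \<open>B ^ n\<close> being \<open>u\<close>.
\<close>

inductive poly_val :: "'a::star_ring \<Rightarrow> 'a \<Rightarrow> nat \<Rightarrow> 'a \<Rightarrow> bool" for B u where
  const: "poly_val B u 0 u"
| step: "z \<in> sym_centre \<Longrightarrow> poly_val B u n w \<Longrightarrow> poly_val B u (Suc n) (z + B * w)"

lemma poly_val_0_iff [simp]: "poly_val B u 0 x \<longleftrightarrow> x = u"
  by (auto elim: poly_val.cases intro: poly_val.const)

text \<open>Polynomials in \<open>B\<close> with central coefficients commute with whatever commutes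
  with \<open>B\<close>. In particular, two values at the same \<open>B\<close> commute, although
  the ring need not be commutative.\<close>

lemma poly_val_commute:
  assumes "poly_val B u n x" "u \<in> sym_centre" "y * B = B * y"
  shows "y * x = x * y"
  using assms
proof induction
  case (step z n w)
  have "y * (B * w) = (B * w) * y"
    using step by (metis mult.assoc)
  then show ?case
    using step.hyps(1) by (simp add: distrib_left distrib_right sym_centre_commute)
qed (metis sym_centre_commute)

lemma poly_val_commute':
  assumes "poly_val B u m x" "u \<in> sym_centre" "poly_val B v n y" "v \<in> sym_centre"
  shows "x * y = y * x"
  using assms by (metis poly_val_commute)

lemma poly_val_star:
  assumes "poly_val B u n x" "u \<in> sym_centre" "star B = B"
  shows "star x = x"
  using assms
proof induction
  case (step z n w)
  have "B * w = w * B"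
    using poly_val_commute[OF step.hyps(2) step.prems(1)] by simp
  with step show ?case
    by (simp add: star_add star_mult sym_centre_star)
qed (rule sym_centre_star)

lemma poly_val_add:
  assumes "poly_val B u n x" "poly_val B v n y"
  shows "poly_val B (u + v) n (x + y)"
  using assms
proof (induction arbitrary: y)
  case (step z n w)
  from step.prems obtain z' w' where y: "y = z' + B * w'" "z' \<in> sym_centre" "poly_val B v n w'"
    by (cases rule: poly_val.cases) auto
  have "z + B * w + y = (z + z') + B * (w + w')"
    using y(1) by (simp add: algebra_simps)
  moreover have "poly_val B (u + v) (Suc n) ((z + z') + B * (w + w'))"
    using step.hyps(1) y step.IH by (intro poly_val.step sym_centre_add) auto
  ultimately show ?case by (simp only:)
qed auto

lemma poly_val_smult:
  assumes "poly_val B u n x" "c \<in> sym_centre"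
  shows "poly_val B (c * u) n (c * x)"
  using assms
proof induction
  case (step z n w)
  have "c * (B * w) = B * (c * w)"
    using sym_centre_commute[OF step.prems, of B] by (simp flip: mult.assoc)
  moreover have "poly_val B (c * u) (Suc n) (c * z + B * (c * w))"
    using step by (intro poly_val.step sym_centre_mult)
  ultimately show ?case by (simp add: distrib_left)
qed (rule poly_val.const)

lemma poly_val_minus:
  assumes "poly_val B u n x"
  shows "poly_val B (- u) n (- x)"
  using poly_val_smult[OF assms sym_centre_minus[OF sym_centre_one]] by simp

lemma poly_val_diff:
  assumes "poly_val B u n x" "poly_val B v n y"
  shows "poly_val B (u - v) n (x - y)"
  using poly_val_add[OF assms(1) poly_val_minus[OF assms(2)]] by simp

text \<open>Degrees are only formal, so a zero leading coefficient may be prepended. Such padding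
  brings values of different degrees to the common degree that \<open>poly_val_add\<close> asks
  for.\<close>

lemma poly_val_Suc:
  assumes "poly_val B u n x" "u \<in> sym_centre"
  shows "poly_val B 0 (Suc n) x"
  using assms
proof induction
  case const
  then show ?case using poly_val.step[OF const poly_val.const[of B 0]] by simp
qed (auto intro: poly_val.step)

lemma poly_val_raise:
  assumes "poly_val B u n x" "u \<in> sym_centre"
  shows "poly_val B 0 (Suc (m + n)) x"
  by (induction m) (use assms in \<open>auto intro: poly_val_Suc\<close>)

lemma poly_val_mult:
  assumes "poly_val B u m x" "u \<in> sym_centre" "poly_val B v n y" "v \<in> sym_centre"
  shows "poly_val B (u * v) (m + n) (x * y)"
  using assms
proof induction
  case const
  then show ?case by (simp add: poly_val_smult)
next
  case (step z m w)
  \<comment> \<open>Padded with zeros, this summand contributes nothing in the top degree, which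
    leaves \<open>u * v\<close> there.\<close>
  have "poly_val B 0 (Suc (m + n)) (z * y)"
    using step by (intro poly_val_raise[of B "z * v"] poly_val_smult sym_centre_mult) auto
  moreover have "poly_val B (u * v) (Suc (m + n)) (0 + B * (w * y))"
    using step by (intro poly_val.step) auto
  ultimately have "poly_val B (0 + u * v) (Suc (m + n)) (z * y + (0 + B * (w * y)))"
    by (rule poly_val_add)
  then show ?case by (simp add: distrib_right mult.assoc)
qed

text \<open>
  Gaussian elimination replaces the determinant: eliminating \<open>g m\<close> keeps the diagonal entries
  monic of one common degree and the other entries of smaller degree.
\<close>

lemma monic_annihilator_of_system:
  assumes "finite S" "k \<in> S"
    and "\<And>i j. i \<in> S \<Longrightarrow> j \<in> S \<Longrightarrow> poly_val B (of_bool (i = j)) n (P i j)"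
    and "\<And>i. i \<in> S \<Longrightarrow> (\<Sum>j\<in>S. P i j * g j) = 0"
  shows "\<exists>N y. poly_val B 1 N y \<and> y * g k = 0"
  using assms
proof (induction "card S" arbitrary: S n P)
  case (Suc r)
  show ?case
  proof (cases "S = {k}")
    case True
    then show ?thesis using Suc.prems(3,4)[of k] by auto
  next
    case False
    then obtain m where m: "m \<in> S" "m \<noteq> k"
      using Suc.prems(2) by blast
    let ?S = "S - {m}"
    \<comment> \<open>Cross-multiplying rows \<open>i\<close> and \<open>m\<close> cancels
      \<open>g m\<close> without any division.\<close>
    define Q where "Q i j = P m m * P i j - P i m * P m j" for i j
    have Pval: "poly_val B (of_bool (i = j)) n (P i j)" if "i \<in> S" "j \<in> S" for i j
      using Suc.prems(3) that by blast
    have "r = card ?S"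
      using Suc.hyps(2) Suc.prems(1) m by simp
    moreover have "poly_val B (of_bool (i = j)) (n + n) (Q i j)" if "i \<in> ?S" "j \<in> ?S" for i j
    proof -
      \<comment> \<open>Since \<open>i\<close> and \<open>j\<close> differ from \<open>m\<close>,
        the entries \<open>P i m\<close> and \<open>P m j\<close> have leading coefficient 0, so
        only the first product reaches the top degree.\<close>
      have "poly_val B (of_bool (m = m) * of_bool (i = j) - of_bool (i = m) * of_bool (m = j))
          (n + n) (Q i j)"
        unfolding Q_def using that m
        by (intro poly_val_diff poly_val_mult Pval sym_centre_of_bool) auto
      then show ?thesis using that by simp
    qed
    moreover have "(\<Sum>j\<in>?S. Q i j * g j) = 0" if i: "i \<in> ?S" for i
    proof -
      have split: "P l m * g m = - (\<Sum>j\<in>?S. P l j * g j)" if "l \<in> S" for l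
        using Suc.prems(4)[OF that] sum.remove[OF Suc.prems(1) m(1), of "\<lambda>j. P l j * g j"]
        by (simp add: eq_neg_iff_add_eq_0)
      have "(\<Sum>j\<in>?S. Q i j * g j)
          = P m m * (\<Sum>j\<in>?S. P i j * g j) - P i m * (\<Sum>j\<in>?S. P m j * g j)"
        by (simp add: Q_def sum_distrib_left sum_subtractf algebra_simps)
      also have "\<dots> = P i m * (P m m * g m) - P m m * (P i m * g m)"
        using i m by (simp add: split)
      also have "\<dots> = 0"
        using poly_val_commute'[OF Pval _ Pval, of m m i m] i m by (simp flip: mult.assoc)
      finally show ?thesis .
    qed
    ultimately show ?thesis
      using Suc.hyps(1)[of ?S "n + n" Q] Suc.prems(1,2) m by blast
  qed
qed auto

section \<open>Finite generation over the symmetric centre\<close>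

definition centre_span :: "'a::star_ring set \<Rightarrow> 'a set" where
  "centre_span S = {\<Sum>g\<in>S. z g * g |z. \<forall>g. z g \<in> sym_centre}"

lemma centre_span_zero: "0 \<in> centre_span S"
  unfolding centre_span_def by (auto intro!: exI[of _ "\<lambda>_. 0"])

lemma centre_span_add:
  assumes "x \<in> centre_span S" "y \<in> centre_span S"
  shows "x + y \<in> centre_span S"
proof -
  obtain z z' where "x = (\<Sum>g\<in>S. z g * g)" "\<forall>g. z g \<in> sym_centre"
    and "y = (\<Sum>g\<in>S. z' g * g)" "\<forall>g. z' g \<in> sym_centre"
    using assms unfolding centre_span_def by auto
  then show ?thesis unfolding centre_span_def
    by (auto intro!: exI[of _ "\<lambda>g. z g + z' g"] sym_centre_add simp: sum.distrib distrib_right)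
qed

lemma centre_span_sum: "(\<And>i. i \<in> T \<Longrightarrow> f i \<in> centre_span S) \<Longrightarrow> sum f T \<in> centre_span S"
  by (induction T rule: infinite_finite_induct) (auto intro: centre_span_add centre_span_zero)

lemma centre_span_base:
  assumes "finite S" "g \<in> S" "z \<in> sym_centre"
  shows "z * g \<in> centre_span S"
proof -
  have "(\<Sum>h\<in>S. (if h = g then z else 0) * h) = z * g"
    using assms by (simp add: if_distrib[of "\<lambda>z. z * _"] cong: if_cong)
  then show ?thesis unfolding centre_span_def
    using assms by (auto intro!: exI[of _ "\<lambda>h. if h = g then z else 0"])
qed

definition finite_over_centre :: "'a::star_ring itself \<Rightarrow> bool" where
  "finite_over_centre _ \<longleftrightarrow> (\<exists>S::'a set. finite S \<and> centre_span S = UNIV)"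

text \<open>The Cayley-Hamilton argument: expanding \<open>B\<close> times each generator in the
  generators gives a square linear system over the polynomials in \<open>B\<close>. Elimination
  yields a monic value killing each single generator; the product of these kills all of them, hence
  kills 1 and is itself 0.\<close>

lemma integral_over_centre:
  fixes B :: "'a::star_ring"
  assumes "finite_over_centre TYPE('a)"
  shows "\<exists>n. poly_val B 1 n 0"
proof -
  obtain S :: "'a set" where S: "finite S" "centre_span S = UNIV"
    using assms unfolding finite_over_centre_def by auto
  have "\<exists>z. (\<forall>g. z g \<in> sym_centre) \<and> x = (\<Sum>g\<in>S. z g * g)" for x
    using S(2) unfolding centre_span_def by blast
  then obtain z where z: "\<And>x g. z x g \<in> sym_centre" and sum: "\<And>x. x = (\<Sum>g\<in>S. z x g * g)"
    by metis
  have kill: "\<exists>N y. poly_val B 1 N y \<and> y * k = 0" if "k \<in> S" for k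
  \<comment> \<open>Row \<open>i\<close> is the expansion of \<open>B * i\<close> moved to one side,
    so \<open>B\<close> has coefficient 1 on the diagonal and 0 elsewhere.\<close>
  proof (rule monic_annihilator_of_system[OF S(1) that,
        where P = "\<lambda>i j. - z (B * i) j + B * of_bool (i = j)" and g = "\<lambda>x. x" and n = "Suc 0"])
    show "poly_val B (of_bool (i = j)) (Suc 0) (- z (B * i) j + B * of_bool (i = j))" for i j
      by (intro poly_val.step sym_centre_minus z poly_val.const)
    show "(\<Sum>j\<in>S. (- z (B * i) j + B * of_bool (i = j)) * j) = 0" if i: "i \<in> S" for i
    proof -
      have "(\<Sum>j\<in>S. (B * of_bool (i = j)) * j) = B * i"
        using S(1) i by (simp add: of_bool_def if_distrib[of "\<lambda>z. z * _"] 
            if_distrib[of "\<lambda>z. B * z"] cong: if_cong)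
      then show ?thesis
        by (simp add: left_diff_distrib sum_subtractf flip: sum)
    qed
  qed
  have "\<exists>N y. poly_val B 1 N y \<and> (\<forall>k\<in>T. y * k = 0)" if "finite T" "T \<subseteq> S" for T
    using that
  proof induction
    case empty
    show ?case by (auto intro: poly_val.const)
  next
    case (insert k T)
    then obtain N y where y: "poly_val B 1 N y" "\<forall>k\<in>T. y * k = 0" by auto
    obtain M x where x: "poly_val B 1 M x" "x * k = 0" using kill[of k] insert.prems by auto
    have "poly_val B 1 (M + N) (x * y)"
      using poly_val_mult[OF x(1) _ y(1)] by simp
    moreover have "x * y * l = 0" if "l \<in> insert k T" for l
    proof (cases "l = k")
      case True
      have "x * y * k = y * (x * k)"
        using poly_val_commute'[OF x(1) _ y(1)] by (simp flip: mult.assoc)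
      then show ?thesis using True x(2) by simp
    next
      case False
      then show ?thesis using that y(2) by (simp add: mult.assoc)
    qed
    ultimately show ?case by blast
  qed
  from this[OF S(1)] obtain N y where y: "poly_val B 1 N y" "\<forall>k\<in>S. y * k = 0" by auto
  have "y = y * (\<Sum>g\<in>S. z 1 g * g)" by (simp flip: sum)
  also have "\<dots> = (\<Sum>g\<in>S. z 1 g * (y * g))"
    by (simp add: sum_distrib_left sym_centre_commute[OF z] mult.assoc)
  also have "\<dots> = 0" using y(2) by simp
  finally show ?thesis using y(1) by auto
qed

subsection \<open>Real ideals of rings finite over their symmetric centre\<close>

text \<open>For a left ideal \<open>I\<close>, this is the annihilator of the left submodule of the
  quotient by \<open>I\<close> generated by the classes of \<open>X\<close>. The factor
  \<open>c\<close> makes it a two-sided ideal.\<close>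

definition quotient_annihilator :: "'a::ring_1 set \<Rightarrow> 'a set \<Rightarrow> 'a set" where
  "quotient_annihilator I X = {z. \<forall>c. \<forall>a\<in>X. z * c * a \<in> I}"

lemma left_ideal_uminus: "left_ideal I \<Longrightarrow> x \<in> I \<Longrightarrow> - x \<in> I"
  unfolding left_ideal_def by (metis mult_minus1)

lemma left_ideal_diff: "left_ideal I \<Longrightarrow> x \<in> I \<Longrightarrow> y \<in> I \<Longrightarrow> x - y \<in> I"
  using left_ideal_uminus[of I y] unfolding left_ideal_def by (metis add_uminus_conv_diff)

lemma real_left_idealD:
  fixes a :: "nat \<Rightarrow> 'a::star_ring"
  assumes "real_left_ideal I" "(\<Sum>i<k. star (a i) * a i) \<in> I" "i < k"
  shows "a i \<in> I"
  using assms unfolding real_left_ideal_def by blast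

lemma real_left_idealD1:
  assumes "real_left_ideal I" "star a * a \<in> I"
  shows "a \<in> I"
  using real_left_idealD[OF assms(1), of "\<lambda>_. a" 1 0] assms(2) by simp

lemma real_left_idealD2:
  assumes "real_left_ideal I" "star a * a + star b * b \<in> I"
  shows "a \<in> I" "b \<in> I"
proof -
  have "(\<Sum>i<2::nat. star (if i = 0 then a else b) * (if i = 0 then a else b)) \<in> I"
    using assms(2) by (simp add: numeral_2_eq_2)
  from real_left_idealD[OF assms(1) this, of 0] real_left_idealD[OF assms(1) this, of 1]
  show "a \<in> I" "b \<in> I" by auto
qed

lemma quotient_annihilator_left_ideal:
  assumes "left_ideal I"
  shows "left_ideal (quotient_annihilator I X)"
  using assms unfolding left_ideal_def quotient_annihilator_def
  by (auto simp: distrib_right mult.assoc)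

lemma quotient_annihilator_right:
  "z \<in> quotient_annihilator I X \<Longrightarrow> z * c \<in> quotient_annihilator I X"
  unfolding quotient_annihilator_def by (simp add: mult.assoc[of z c])

text \<open>Multiplying a sum of hermitian squares by \<open>star (c * a)\<close> on the left and
  \<open>c * a\<close> on the right gives again such a sum, now inside \<open>I\<close>, where
  realness applies.\<close>

lemma quotient_annihilator_real:
  assumes "real_left_ideal I"
  shows "real_left_ideal (quotient_annihilator I X)"
  unfolding real_left_ideal_def
proof (intro conjI allI impI)
  have li: "left_ideal I" using assms unfolding real_left_ideal_def by simp
  then show "left_ideal (quotient_annihilator I X)" by (rule quotient_annihilator_left_ideal)
  fix k i :: nat and w :: "nat \<Rightarrow> 'a"
  assume w: "(\<Sum>i<k. star (w i) * w i) \<in> quotient_annihilator I X" and i: "i < k"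
  show "w i \<in> quotient_annihilator I X" unfolding quotient_annihilator_def
  proof (intro CollectI allI ballI)
    fix c a assume a: "a \<in> X"
    have "(\<Sum>i<k. star (w i * c * a) * (w i * c * a))
        = star (c * a) * ((\<Sum>i<k. star (w i) * w i) * c * a)"
      by (simp add: star_mult sum_distrib_left sum_distrib_right mult.assoc)
    also have "\<dots> \<in> I"
      using w a li unfolding quotient_annihilator_def left_ideal_def by blast
    finally show "w i * c * a \<in> I"
      using real_left_idealD[OF assms, of "\<lambda>i. w i * c * a"] i by blast
  qed
qed

text \<open>The right ideal property puts \<open>z * star z\<close> into the annihilator; this is
  the hermitian square of \<open>star z\<close>, so realness applies.\<close>

lemma quotient_annihilator_star:
  assumes "real_left_ideal I" "z \<in> quotient_annihilator I X"
  shows "star z \<in> quotient_annihilator I X"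
  using quotient_annihilator_right[OF assms(2), of "star z"]
    real_left_idealD1[OF quotient_annihilator_real[OF assms(1)], of "star z"] by simp

text \<open>
  If \<open>e * a = y + z\<close> with \<open>y \<in> I\<close> and \<open>z\<close> in the annihilator of \<open>a\<close> modulo \<open>I\<close>, then
  multiplying by \<open>star z\<close> on the left gives \<open>star z * z \<in> I\<close>, and so \<open>z \<in> I\<close>.
\<close>

lemma central_mult_mem_if_mem_plus_annihilator:
  assumes "real_left_ideal I" "a \<in> X" "e \<in> sym_centre"
    and "y \<in> I" "z \<in> quotient_annihilator I X" "e * a = y + z"
  shows "e * a \<in> I"
proof -
  have li: "left_ideal I" using assms(1) unfolding real_left_ideal_def by simp
  have "star z * e * a \<in> I"
    using quotient_annihilator_star[OF assms(1,5)] assms(2)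
    unfolding quotient_annihilator_def by blast
  moreover have "star z * y \<in> I"
    using li assms(4) unfolding left_ideal_def by blast
  moreover have "star z * z = star z * e * a - star z * y"
    using assms(6) by (simp add: mult.assoc distrib_left)
  ultimately have "star z * z \<in> I"
    using left_ideal_diff[OF li] by metis
  then have "z \<in> I" by (rule real_left_idealD1[OF assms(1)])
  then show ?thesis using assms(4,6) li unfolding left_ideal_def by metis
qed

section \<open>Equivalence of real and strongly real\<close>

lemma real_imp_strongly_real:
  fixes I :: "'a::star_ring set"
  assumes fin: "finite_over_centre TYPE('a)" and I: "real_left_ideal I"
  shows "strongly_real_left_ideal I"
  unfolding strongly_real_left_ideal_def
proof (intro conjI allI impI)
  show li: "left_ideal I" using I unfolding real_left_ideal_def by simp
  fix k i :: nat and a :: "nat \<Rightarrow> 'a"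
  assume "(\<Sum>i<k. star (a i) * a i) \<in> {x + star y |x y. x \<in> I \<and> y \<in> I}" and i: "i < k"
  then obtain b c where bc: "b \<in> I" "c \<in> I" and s: "(\<Sum>i<k. star (a i) * a i) = b + star c"
    by auto
  define X where "X = a ` {..<k}"
  define K where "K = quotient_annihilator I X"
  define B where "B = star b * b + star c * c"
  have K: "real_left_ideal K"
    unfolding K_def by (rule quotient_annihilator_real[OF I])
  then have liK: "left_ideal K" unfolding real_left_ideal_def by simp
  have K_mult: "x * y \<in> K" if "x \<in> K \<or> y \<in> K" for x y
    using that liK quotient_annihilator_right[of x I X y] unfolding K_def left_ideal_def by blast
  have K_add: "x + y \<in> K" if "x \<in> K" "y \<in> K" for x y
    using that liK unfolding left_ideal_def by blast
  have BI: "B \<in> I"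
    using bc li unfolding B_def left_ideal_def by simp
  have starB: "star B = B"
    by (simp add: B_def star_add star_mult)
  \<comment> \<open>Descent on the degree of \<open>q\<close>; both memberships are passed on from
    \<open>q\<close> to \<open>q'\<close>.\<close>
  have "X \<subseteq> I" if "poly_val B 1 n q" "B * q \<in> K" "\<forall>x\<in>X. x * q \<in> K" for n q
    using that
  proof (induction n arbitrary: q)
    case 0
    then have "x \<in> K" if "x \<in> X" for x using that by simp
    \<comment> \<open>Here \<open>q = 1\<close>, so \<open>x\<close> itself lies in
      \<open>K\<close>; the splitting \<open>1 * x = 0 + x\<close> then gives membership in
      \<open>I\<close>.\<close>
    then show ?case
      using central_mult_mem_if_mem_plus_annihilator[OF I _ sym_centre_one, of _ X 0] li
      unfolding K_def left_ideal_def by auto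
  next
    case (Suc n)
    from Suc.prems(1) obtain e q' where q: "q = e + B * q'" and e: "e \<in> sym_centre"
      and q': "poly_val B 1 n q'"
      by (cases rule: poly_val.cases) auto
    have comm: "B * q' = q' * B"
      using poly_val_commute[OF q' sym_centre_one, of B] by simp
    have sq': "star q' = q'" and sq: "star q = q"
      using poly_val_star[OF q' _ starB] poly_val_star[OF Suc.prems(1) _ starB] by auto
    have eK: "e \<in> K" unfolding K_def quotient_annihilator_def
    proof (intro CollectI allI ballI)
      fix c x assume x: "x \<in> X"
      \<comment> \<open>As \<open>e\<close> is central,
        \<open>e * x = x * e = x * (q - q' * B)\<close>. The part ending in \<open>B\<close> lies in
        the left ideal \<open>I\<close>, the other one in \<open>K\<close>.\<close>
      have "e * x = - (x * q' * B) + x * q"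
        using sym_centre_commute[OF e, of x] by (simp add: q comm algebra_simps)
      moreover have "- (x * q' * B) \<in> I"
        using BI li left_ideal_uminus[OF li] unfolding left_ideal_def by blast
      ultimately have "e * x \<in> I"
        using central_mult_mem_if_mem_plus_annihilator[OF I x e] Suc.prems(3) x
        unfolding K_def by blast
      then have "c * (e * x) \<in> I" using li unfolding left_ideal_def by blast
      then show "e * c * x \<in> I" by (simp add: sym_centre_commute[OF e] mult.assoc)
    qed
    have "star q * q = e * q + q' * (B * q)"
      by (simp only: sq) (simp add: q comm algebra_simps)
    then have "star q * q \<in> K"
      using eK Suc.prems(2) K_mult K_add by simp
    then have "q \<in> K" by (rule real_left_idealD1[OF K])
    then have Bq': "B * q' \<in> K"
      using left_ideal_diff[OF liK _ eK] by (metis q add_diff_cancel_left')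
    have "star (b * q') * (b * q') + star (c * q') * (c * q') = q' * (B * q')"
      by (simp add: B_def star_mult sq' algebra_simps)
    then have "star (b * q') * (b * q') + star (c * q') * (c * q') \<in> K"
      using Bq' K_mult by simp
    then have bq: "b * q' \<in> K" and cq: "c * q' \<in> K"
      using real_left_idealD2[OF K] by blast+
    have "(\<Sum>i<k. star (a i * q') * (a i * q')) = q' * (\<Sum>i<k. star (a i) * a i) * q'"
      by (simp add: star_mult sq' sum_distrib_left sum_distrib_right mult.assoc)
    \<comment> \<open>Bracketed so that each summand has a factor known to lie in \<open>K\<close>,
      on the right in one and on the left in the other.\<close>
    also have "\<dots> = q' * (b * q') + star (c * q') * q'"
      by (simp add: s star_mult sq' algebra_simps)
    also have "\<dots> \<in> K"
      using bq quotient_annihilator_star[OF I cq[unfolded K_def]]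
      by (intro K_add K_mult) (auto simp: K_def)
    finally have "\<forall>x\<in>X. x * q' \<in> K"
      using real_left_idealD[OF K, of "\<lambda>i. a i * q'" k] unfolding X_def by blast
    then show ?case using Suc.IH[OF q' Bq'] by blast
  qed
  \<comment> \<open>The descent starts from a monic relation, \<open>q = 0\<close>, for which both
    memberships are trivial.\<close>
  moreover obtain n where "poly_val B 1 n 0"
    using integral_over_centre[OF fin] by blast
  moreover have "0 \<in> K" using liK unfolding left_ideal_def by blast
  ultimately show "a i \<in> I"
    using i unfolding X_def by fastforce
qed

lemma strongly_real_imp_real:
  fixes I :: "'a::star_ring set"
  assumes "strongly_real_left_ideal I"
  shows "real_left_ideal I"
  unfolding real_left_ideal_def
proof (intro conjI allI impI)
  show li: "left_ideal I" using assms unfolding strongly_real_left_ideal_def by simp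
  fix k i :: nat and a :: "nat \<Rightarrow> 'a"
  assume "(\<Sum>i<k. star (a i) * a i) \<in> I" "i < k"
  moreover have "x \<in> {x + star y |x y. x \<in> I \<and> y \<in> I}" if "x \<in> I" for x
    using that li unfolding left_ideal_def by (force intro: exI[of _ 0])
  ultimately show "a i \<in> I"
    using assms unfolding strongly_real_left_ideal_def by blast
qed

lemma real_left_ideal_iff_strongly_real:
  fixes I :: "'a::star_ring set"
  assumes "finite_over_centre TYPE('a)"
  shows "real_left_ideal I \<longleftrightarrow> strongly_real_left_ideal I"
  using real_imp_strongly_real[OF assms] strongly_real_imp_real by blast

subsection \<open>The matrix rings\<close>

text \<open>Not the identity: the matrix unit at position \<open>(i, j)\<close>, scaled by
  \<open>b\<close>.\<close>

lift_definition unit_matrix :: "'n \<Rightarrow> 'n \<Rightarrow> 'b \<Rightarrow> ('b::star_ring, 'n::finite) sq_matrix"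
  is "\<lambda>i j b. \<chi> k l. if k = i \<and> l = j then b else 0" .

lift_definition scalar_matrix :: "'b \<Rightarrow> ('b::star_ring, 'n::finite) sq_matrix" is mat .

lemma scalar_matrix_sym_centre:
  "z \<in> sym_centre \<Longrightarrow> scalar_matrix z \<in> sym_centre"
  unfolding sym_centre_def mem_Collect_eq
  by (transfer, auto simp: mat_def vec_eq_iff matrix_matrix_mult_def if_distrib[of "\<lambda>z. z * _"]
      if_distrib[of "\<lambda>z. _ * z"] cong: if_cong)

lemma scalar_mult_unit_matrix:
  "scalar_matrix z * unit_matrix i j b = unit_matrix i j (z * b)"
  by transfer (auto simp: mat_def vec_eq_iff matrix_matrix_mult_def if_distrib[of "\<lambda>z. z * _"]
      cong: if_cong)

lemma unit_matrix_zero: "unit_matrix i j 0 = 0"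
  by transfer (simp add: vec_eq_iff)

lemma unit_matrix_add: "unit_matrix i j (x + y) = unit_matrix i j x + unit_matrix i j y"
  by transfer (simp add: vec_eq_iff)

lemma unit_matrix_sum: "unit_matrix i j (sum f S) = (\<Sum>x\<in>S. unit_matrix i j (f x))"
  by (induction S rule: infinite_finite_induct) (simp_all add: unit_matrix_zero unit_matrix_add)

lemma Rep_sq_matrix_sum: "Rep_sq_matrix (sum f S) = (\<Sum>x\<in>S. Rep_sq_matrix (f x))"
  by (induction S rule: infinite_finite_induct)
    (simp_all add: zero_sq_matrix.rep_eq plus_sq_matrix.rep_eq)

lemma sq_matrix_expand:
  fixes A :: "('b::star_ring, 'n::finite) sq_matrix"
  shows "A = (\<Sum>i\<in>UNIV. \<Sum>j\<in>UNIV. unit_matrix i j (Rep_sq_matrix A $ i $ j))"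
proof -
  have "(\<Sum>i\<in>UNIV. \<Sum>j\<in>UNIV. if k = i \<and> l = j then X $ i $ j else 0) = X $ k $ l"
    for k l and X :: "'b ^ 'n ^ 'n"
  proof -
    have "(\<Sum>j\<in>UNIV. if k = i \<and> l = j then X $ i $ j else 0) = (if k = i then X $ i $ l else 0)"
      for i
      by (cases "k = i") simp_all
    then show ?thesis by simp
  qed
  then show ?thesis
    by (simp add: Rep_sq_matrix_inject[symmetric] Rep_sq_matrix_sum unit_matrix.rep_eq vec_eq_iff)
qed

text \<open>Matrix units scaled by the generators of the base ring suffice, because symmetric
  central coefficients turn into scalar matrices that are again symmetric and central.\<close>

lemma finite_over_centre_sq_matrix:
  assumes "finite_over_centre TYPE('b::star_ring)"
  shows "finite_over_centre TYPE(('b, 'n::finite) sq_matrix)"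
proof -
  obtain S :: "'b set" where S: "finite S" "centre_span S = UNIV"
    using assms unfolding finite_over_centre_def by auto
  define T :: "('b, 'n) sq_matrix set"
    where "T = (\<lambda>(i, j, g). unit_matrix i j g) ` (UNIV \<times> UNIV \<times> S)"
  have T: "finite T" unfolding T_def using S(1) by simp
  have "unit_matrix i j x \<in> centre_span T" for i j x
  proof -
    obtain z where z: "x = (\<Sum>g\<in>S. z g * g)" "\<And>g. z g \<in> sym_centre"
      using S(2) unfolding centre_span_def by blast
    have "unit_matrix i j x = (\<Sum>g\<in>S. scalar_matrix (z g) * unit_matrix i j g)"
      by (simp add: z(1) unit_matrix_sum scalar_mult_unit_matrix)
    also have "\<dots> \<in> centre_span T"
      by (intro centre_span_sum centre_span_base[OF T] scalar_matrix_sym_centre z(2))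
        (force simp: T_def)
    finally show ?thesis .
  qed
  then have "A \<in> centre_span T" for A
    by (subst sq_matrix_expand) (intro centre_span_sum)
  with T show ?thesis unfolding finite_over_centre_def by blast
qed

subsection \<open>The coefficient rings\<close>

lemma poly_mapping_induct_add [case_names zero single add]:
  fixes p :: "'a \<Rightarrow>\<^sub>0 'b::comm_monoid_add"
  assumes "P 0" "\<And>m c. P (Poly_Mapping.single m c)" "\<And>p q. P p \<Longrightarrow> P q \<Longrightarrow> P (p + q)"
  shows "P p"
proof (induction p rule: update_induct)
  case const
  show ?case by (rule assms(1))
next
  case (update p m c)
  \<comment> \<open>The exponent \<open>m\<close> is not yet in the support of \<open>p\<close>, so
    updating amounts to adding a monomial.\<close>
  have "Poly_Mapping.update m c p = Poly_Mapping.single m c + p"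
    using update.hyps(1)
    by (intro poly_mapping_eqI)
      (auto simp: lookup_update lookup_add lookup_single in_keys_iff when_def)
  then show ?case using assms(2,3) update.IH by simp
qed

lemma single_sum:
  "Poly_Mapping.single m (sum f S) = (\<Sum>x\<in>S. Poly_Mapping.single m (f x))"
  by (induction S rule: infinite_finite_induct) (simp_all add: single_add)

lemma single_sym_centre:
  fixes c :: "'b::star_ring"
  assumes "c \<in> sym_centre"
  shows "(Poly_Mapping.single m c :: 'a::comm_monoid_add \<Rightarrow>\<^sub>0 'b) \<in> sym_centre"
proof -
  have "Poly_Mapping.single m c * p = p * Poly_Mapping.single m c" for p :: "'a \<Rightarrow>\<^sub>0 'b"
    by (induction p rule: poly_mapping_induct_add)
      (simp_all add: mult_single add.commute sym_centre_commute[OF assms] distrib_left distrib_right)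
  then show ?thesis
    using assms by (simp add: sym_centre_def star_single)
qed

text \<open>The generators of the coefficient ring, taken as constants, still suffice: monomials
  with symmetric central coefficients are symmetric and central, so the variables are absorbed into
  the scalars.\<close>

lemma finite_over_centre_poly_mapping:
  assumes "finite_over_centre TYPE('b::star_ring)"
  shows "finite_over_centre TYPE('a::comm_monoid_add \<Rightarrow>\<^sub>0 'b)"
proof -
  obtain S :: "'b set" where S: "finite S" "centre_span S = UNIV"
    using assms unfolding finite_over_centre_def by auto
  define T :: "('a \<Rightarrow>\<^sub>0 'b) set" where "T = Poly_Mapping.single 0 ` S"
  have T: "finite T" unfolding T_def using S(1) by simp
  have "p \<in> centre_span T" for p
  proof (induction p rule: poly_mapping_induct_add)
    case zero
    show ?case by (rule centre_span_zero)
  next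
    case (single m c)
    obtain z where z: "c = (\<Sum>g\<in>S. z g * g)" "\<And>g. z g \<in> sym_centre"
      using S(2) unfolding centre_span_def by blast
    have "Poly_Mapping.single m c = (\<Sum>g\<in>S. Poly_Mapping.single m (z g) * Poly_Mapping.single 0 g)"
      by (simp add: z(1) mult_single single_sum)
    also have "\<dots> \<in> centre_span T"
      by (intro centre_span_sum centre_span_base[OF T] single_sym_centre z(2)) (auto simp: T_def)
    finally show ?case .
  next
    case (add p q)
    then show ?case by (rule centre_span_add)
  qed
  with T show ?thesis unfolding finite_over_centre_def by blast
qed

lemma finite_over_centre_real: "finite_over_centre TYPE(real)"
proof -
  have "x \<in> centre_span {1}" for x :: real
    using centre_span_base[of "{1}" 1 x] by (simp add: sym_centre_def star_real_def)
  then show ?thesis unfolding finite_over_centre_def by blast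
qed

lemma Quat_real_sym_centre: "Quat r 0 0 0 \<in> sym_centre"
  by (auto simp: sym_centre_def star_quat_def quat_eq_iff times_quat_def)

definition quat_basis :: "quat set" where
  "quat_basis = {Quat 1 0 0 0, Quat 0 1 0 0, Quat 0 0 1 0, Quat 0 0 0 1}"

text \<open>The basis is orthonormal for the inner product \<open>Re_q (q * star g)\<close>, which
  therefore reads off the coordinates.\<close>

lemma quat_expand:
  "q = (\<Sum>g\<in>quat_basis. Quat (Re_q (q * star g)) 0 0 0 * g)"
  by (simp add: quat_basis_def quat_eq_iff plus_quat_def times_quat_def star_quat_def zero_quat_def
      one_quat_def)

lemma finite_over_centre_quat: "finite_over_centre TYPE(quat)"
proof -
  have fin: "finite quat_basis" by (simp add: quat_basis_def)
  have "q \<in> centre_span quat_basis" for q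
    by (subst quat_expand) (intro centre_span_sum centre_span_base[OF fin] Quat_real_sym_centre)
  with fin show ?thesis unfolding finite_over_centre_def by blast
qed

text \<open>In this form the real part of a polynomial function is visibly polynomial, since
  conjugation preserves polynomial functions.\<close>

lemma Quat_Re_eq: "Quat (Re_q q) 0 0 0 = Quat (1/2) 0 0 0 * (q + star q)"
  by (simp add: quat_eq_iff star_quat_def plus_quat_def times_quat_def)

lift_definition const_quat_poly_fun :: "quat \<Rightarrow> 'd::finite quat_poly_fun" is "\<lambda>c _. c"
  by (rule quat_poly_funs.const)

lift_definition re_quat_poly_fun :: "'d::finite quat_poly_fun \<Rightarrow> 'd quat_poly_fun"
  is "\<lambda>f x. Quat (Re_q (f x)) 0 0 0"
  unfolding Quat_Re_eq by (intro quat_poly_funs.intros quat_poly_funs_star)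

lemma re_quat_poly_fun_sym_centre:
  "re_quat_poly_fun (f :: 'd::finite quat_poly_fun) \<in> sym_centre"
  unfolding sym_centre_def mem_Collect_eq
  by (transfer, auto simp: fun_eq_iff sym_centre_commute[OF Quat_real_sym_centre]
      sym_centre_star[OF Quat_real_sym_centre])

lemma Rep_quat_poly_fun_sum:
  "Rep_quat_poly_fun (sum f S :: 'd::finite quat_poly_fun) x = (\<Sum>i\<in>S. Rep_quat_poly_fun (f i) x)"
  by (induction S rule: infinite_finite_induct)
    (simp_all add: zero_quat_poly_fun.rep_eq plus_quat_poly_fun.rep_eq)

text \<open>This is \<open>quat_expand\<close> at every point; the coordinates are real-valued
  polynomial functions and hence lie in the symmetric centre.\<close>

lemma quat_poly_fun_expand:
  "f = (\<Sum>g\<in>quat_basis. re_quat_poly_fun (f * star (const_quat_poly_fun g)) * const_quat_poly_fun g)"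
  for f :: "'d::finite quat_poly_fun"
  unfolding Rep_quat_poly_fun_inject[symmetric]
  by (rule ext) (simp add: Rep_quat_poly_fun_sum times_quat_poly_fun.rep_eq
      re_quat_poly_fun.rep_eq star_quat_poly_fun.rep_eq const_quat_poly_fun.rep_eq
      flip: quat_expand)

lemma finite_over_centre_quat_poly_fun: "finite_over_centre TYPE('d::finite quat_poly_fun)"
proof -
  define T :: "'d quat_poly_fun set" where "T = const_quat_poly_fun ` quat_basis"
  have T: "finite T" by (simp add: T_def quat_basis_def)
  have "f \<in> centre_span T" for f
    by (subst quat_poly_fun_expand)
      (intro centre_span_sum centre_span_base[OF T] re_quat_poly_fun_sym_centre, simp add: T_def)
  with T show ?thesis unfolding finite_over_centre_def by blast
qed

theorem corollary1:
  shows "(\<forall>I :: (('d::finite, real) mpoly, 'n::finite) sq_matrix set.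
            left_ideal I \<longrightarrow> (real_left_ideal I \<longleftrightarrow> strongly_real_left_ideal I)) \<and>
         (\<forall>I :: (('d, quat) mpoly, 'n) sq_matrix set.
            left_ideal I \<longrightarrow> (real_left_ideal I \<longleftrightarrow> strongly_real_left_ideal I)) \<and>
         (\<forall>I :: ('d quat_poly_fun, 'n) sq_matrix set.
            left_ideal I \<longrightarrow> (real_left_ideal I \<longleftrightarrow> strongly_real_left_ideal I))"
  by (intro conjI allI impI real_left_ideal_iff_strongly_real finite_over_centre_sq_matrix
      finite_over_centre_poly_mapping finite_over_centre_real finite_over_centre_quat
      finite_over_centre_quat_poly_fun)

end
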